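(* Let $G$ be an Eulerian digraph. Put $$\mathfrak{g}_{\max} = |E(G)| - \mathrm{minfas}(G) - |V(G)| + 1, \qquad \mathfrak{g}_{\min} = \mathrm{minfas}(G) - |V(G)| + 1,$$ and let $K_G \in \mathrm{Div}(G)$ be the divisor with $K_G(v) = d^+(v) - 2$ for each $v \in V(G)$. Then for every divisor $f \in \mathrm{Div}(G)$, $$\deg(f) - \mathfrak{g}_{\max} + 1 \;\leq\; \mathrm{rank}(f) - \mathrm{rank}(K_G - f) \;\leq\; \deg(f) - \mathfrak{g}_{\min} + 1 .$$
   Context: A digraph is a finite directed graph, possibly with multiple edges but without loops; all digraphs are assumed weakly connected (the underlying undirected graph is connected). $V(G)$ and $E(G)$ are the vertex and edge sets; $\overrightarrow{d}(u,v)$ is the number of directed edges from $u$ to $v$; $d^-(v)$ and $d^+(v)$ are the indegree and outdegree of $v$ (counted with multiplicity). $G$ is Eulerian if $d^+(v)=d^-(v)$ for every vertex $v$. A feedback arc set of $G$ is a set $F\subseteq E(G)$ such that the digraph $(V(G),E(G)\setminus F)$ is acyclic (has no directed cycle); $\mathrm{minfas}(G)$ is the minimum cardinality of a feedback arc set of $G$. $\mathrm{Div}(G)$ is the free Abelian group on $V(G)$, identified with $\mathbb{Z}^{V(G)}$; its elements are called divisors. For $f\in \mathbb{Z}^{V(G)}$, $\deg(f)=\sum_{v\in V(G)} f(v)$. The Laplacian matrix $L\in\mathbb{Z}^{V(G)\times V(G)}$ is defined by $L(u,u)=-d^+(u)$ and $L(u,v)=\overrightarrow{d}(v,u)$ for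 $u\neq v$. Two vectors $x,y\in\mathbb{Z}^{V(G)}$ are linearly equivalent, $x\sim y$, if $x=y+Lz$ for some $z\in\mathbb{Z}^{V(G)}$. A divisor is effective if all its coordinates are nonnegative, and equi-effective if it is linearly equivalent to an effective divisor. The rank of a divisor $f$ is $$\mathrm{rank}(f)=\min\{\deg(g)-1 : g\in\mathrm{Div}(G),\ g \text{ effective},\ f-g \text{ not equi-effective}\}.$$ *)

theory Defs
  imports "Graph_Theory.Graph_Theory"
begin

text \<open>
  Digraphs are those of \<^locale>\<open>fin_digraph\<close> and \<^locale>\<open>loopfree_digraph\<close>, so parallel arcs are
  allowed (the locale \<^locale>\<open>digraph\<close> would exclude them). Weak connectedness is \<^const>\<open>connected\<close>,
  which also requires a nonempty vertex set.
\<close>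

definition eulerian :: "('a, 'b) pre_digraph \<Rightarrow> bool" where
  "eulerian G \<longleftrightarrow> (\<forall>v \<in> verts G. out_degree G v = in_degree G v)"

definition arc_mult :: "('a, 'b) pre_digraph \<Rightarrow> 'a \<Rightarrow> 'a \<Rightarrow> nat" where
  "arc_mult G u v = card {e \<in> arcs G. tail G e = u \<and> head G e = v}"

definition acyclic_digraph :: "('a, 'b) pre_digraph \<Rightarrow> bool" where
  "acyclic_digraph G \<longleftrightarrow> \<not> (\<exists>p. pre_digraph.cycle G p)"

definition feedback_arc_set :: "('a, 'b) pre_digraph \<Rightarrow> 'b set \<Rightarrow> bool" where
  "feedback_arc_set G F \<longleftrightarrow> F \<subseteq> arcs G \<and> acyclic_digraph (G\<lparr>arcs := arcs G - F\<rparr>)"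

definition minfas :: "('a, 'b) pre_digraph \<Rightarrow> nat" where
  "minfas G = Min (card ` {F. feedback_arc_set G F})"

text \<open>
  An element of $\mathbb{Z}^{V(G)}$ is a function on the whole vertex type that vanishes
  outside \<^term>\<open>verts G\<close>, so equality and subtraction of divisors are those of functions.
\<close>

definition Div :: "('a, 'b) pre_digraph \<Rightarrow> ('a \<Rightarrow> int) set" where
  "Div G = {f. \<forall>v. v \<notin> verts G \<longrightarrow> f v = 0}"

definition div_deg :: "('a, 'b) pre_digraph \<Rightarrow> ('a \<Rightarrow> int) \<Rightarrow> int" where
  "div_deg G f = (\<Sum>v \<in> verts G. f v)"

definition laplacian :: "('a, 'b) pre_digraph \<Rightarrow> 'a \<Rightarrow> 'a \<Rightarrow> int" where
  "laplacian G u v = (if u = v then - int (out_degree G u) else int (arc_mult G v u))"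

text \<open>
  The product of the Laplacian matrix with a vector; the result is again in \<^const>\<open>Div\<close>.
\<close>

definition laplacian_app :: "('a, 'b) pre_digraph \<Rightarrow> ('a \<Rightarrow> int) \<Rightarrow> 'a \<Rightarrow> int" where
  "laplacian_app G z u = (if u \<in> verts G then \<Sum>v \<in> verts G. laplacian G u v * z v else 0)"

definition lin_equiv :: "('a, 'b) pre_digraph \<Rightarrow> ('a \<Rightarrow> int) \<Rightarrow> ('a \<Rightarrow> int) \<Rightarrow> bool" where
  "lin_equiv G x y \<longleftrightarrow> (\<exists>z \<in> Div G. x = (\<lambda>v. y v + laplacian_app G z v))"

definition effective :: "('a, 'b) pre_digraph \<Rightarrow> ('a \<Rightarrow> int) \<Rightarrow> bool" where
  "effective G f \<longleftrightarrow> f \<in> Div G \<and> (\<forall>v \<in> verts G. 0 \<le> f v)"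

definition equi_effective :: "('a, 'b) pre_digraph \<Rightarrow> ('a \<Rightarrow> int) \<Rightarrow> bool" where
  "equi_effective G f \<longleftrightarrow> (\<exists>h. effective G h \<and> lin_equiv G f h)"

text \<open>
  On a nonempty finite digraph the set of candidate values below is nonempty (linear equivalence
  preserves the degree, so any effective divisor of degree above that of \<open>f\<close> qualifies) and bounded
  below by -1, hence the minimum is attained.
\<close>

definition div_rank :: "('a, 'b) pre_digraph \<Rightarrow> ('a \<Rightarrow> int) \<Rightarrow> int" where
  "div_rank G f =
    (LEAST r. \<exists>g. effective G g \<and> \<not> equi_effective G (f - g) \<and> r = div_deg G g - 1)"

definition genus_max :: "('a, 'b) pre_digraph \<Rightarrow> int" where
  "genus_max G = int (card (arcs G)) - int (minfas G) - int (card (verts G)) + 1"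

definition genus_min :: "('a, 'b) pre_digraph \<Rightarrow> int" where
  "genus_min G = int (minfas G) - int (card (verts G)) + 1"

definition canonical_div :: "('a, 'b) pre_digraph \<Rightarrow> 'a \<Rightarrow> int" where
  "canonical_div G v = (if v \<in> verts G then int (out_degree G v) - 2 else 0)"

end

theory Submission
  imports Defs
begin

text \<open>
  The proof transfers the Baker--Norine argument for graphs to Eulerian digraphs. Order the vertices
  and let \<open>\<nu>(v)\<close> be the number of arcs that enter \<open>v\<close> from earlier vertices, minus one. Three
  facts about these divisors give the theorem.

  First, the divisors \<open>\<nu>\<close> account for all divisors that are not equi-effective. None of them
  is equi-effective: since the in- and outdegree agree, applying the Laplacian to \<open>z\<close> gives \<open>v\<close>
  the value of the sum of \<open>z(tail e) - z(v)\<close> over the arcs \<open>e\<close> entering \<open>v\<close>, so the earliest vertex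
  at which \<open>z\<close> is maximal ends up negative (\<open>not_equi_effective_order_div\<close>). Conversely, every
  divisor that is not equi-effective is equivalent to one below some \<open>\<nu>\<close>
  (\<open>not_equi_effective_imp_below_order_div\<close>): choose an equivalent divisor with the
  least possible debt that can fire no further set of vertices, and let Dhar's
  burning process produce the order.

  Second, \<open>K - \<nu>\<close> is the divisor of the reversed order, because each arc entering \<open>v\<close> comes
  either from an earlier or from a later vertex (\<open>canonical_div_minus_order_div\<close>).

  Third, the degree of \<open>\<nu>\<close> is at most \<open>genus_max G - 1\<close>, because the arcs that go backwards
  in the order form a feedback arc set (\<open>div_deg_order_div_le\<close>).

  Now let \<open>g\<close> be an effective divisor that attains the rank of \<open>f\<close>, so that \<open>f - g\<close> is equivalent to
  \<open>\<nu> - e\<close> with \<open>e\<close> effective. Then \<open>(K - f) - e\<close> is equivalent to \<open>(K - \<nu>) - g\<close>, which lies below the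
  divisor of the reversed order and hence is not equi-effective. So \<open>deg e - 1\<close> bounds the rank of
  \<open>K - f\<close>, and \<open>deg e = deg \<nu> - deg f + deg g\<close> yields the lower bound. The upper bound is
  the lower bound for \<open>K - f\<close>, as \<open>deg K = genus_max G + genus_min G - 2\<close>.
\<close>

text \<open>
  The order on the vertices is given by an integer-valued position function, so that
  reversing the order is negating the function.
\<close>

definition order_div :: "('a, 'b) pre_digraph \<Rightarrow> ('a \<Rightarrow> int) \<Rightarrow> 'a \<Rightarrow> int" where
  "order_div G p v =
    (if v \<in> verts G then int (card {e \<in> in_arcs G v. p (tail G e) < p v}) - 1 else 0)"

locale connected_eulerian_digraph = fin_digraph G + loopfree_digraph G
  for G :: "('a, 'b) pre_digraph" +
  assumes connected_G: "connected G"
    and eulerian_G: "eulerian G"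
begin

section \<open>The Laplacian of an Eulerian digraph\<close>

lemma verts_nonempty: "verts G \<noteq> {}"
  using connected_G by (auto simp: connected_def strongly_connected_def)

lemma sum_in_arcs:
  assumes "finite S"
  shows "(\<Sum>v\<in>S. \<Sum>e\<in>in_arcs G v. h e) = (\<Sum>e | e \<in> arcs G \<and> head G e \<in> S. h e)"
proof -
  have "(\<Sum>v\<in>S. \<Sum>e | e \<in> {e \<in> arcs G. head G e \<in> S} \<and> head G e = v. h e)
      = (\<Sum>e\<in>{e \<in> arcs G. head G e \<in> S}. h e)"
    by (rule sum.group) (use assms in auto)
  moreover have "{e. e \<in> {e \<in> arcs G. head G e \<in> S} \<and> head G e = v} = in_arcs G v" if "v \<in> S" for v
    using that by auto
  ultimately show ?thesis by simp
qed

lemma sum_out_arcs: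
  assumes "finite S"
  shows "(\<Sum>v\<in>S. \<Sum>e\<in>out_arcs G v. h e) = (\<Sum>e | e \<in> arcs G \<and> tail G e \<in> S. h e)"
proof -
  have "(\<Sum>v\<in>S. \<Sum>e | e \<in> {e \<in> arcs G. tail G e \<in> S} \<and> tail G e = v. h e)
      = (\<Sum>e\<in>{e \<in> arcs G. tail G e \<in> S}. h e)"
    by (rule sum.group) (use assms in auto)
  moreover have "{e. e \<in> {e \<in> arcs G. tail G e \<in> S} \<and> tail G e = v} = out_arcs G v" if "v \<in> S" for v
    using that by auto
  ultimately show ?thesis by simp
qed

lemma card_filter_eq_sum:
  assumes "finite S"
  shows "int (card {e \<in> S. P e}) = (\<Sum>e\<in>S. if P e then 1 else 0)"
  using assms by (simp add: sum.If_cases Int_def)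

lemma card_out_arcs_eq_card_in_arcs:
  assumes "v \<in> verts G"
  shows "card (out_arcs G v) = card (in_arcs G v)"
  using eulerian_G assms by (simp add: eulerian_def out_degree_def in_degree_def)

text \<open>
  The place where the Eulerian condition enters the description of the Laplacian: the outdegree on its
  diagonal may be replaced by the indegree, so that every entering arc contributes the
  difference of the values at its two ends.
\<close>

lemma laplacian_app_eq:
  assumes u: "u \<in> verts G"
  shows "laplacian_app G z u = (\<Sum>e\<in>in_arcs G u. z (tail G e) - z u)"
proof -
  have no_loop: "arc_mult G u u = 0"
    using no_loops by (fastforce simp: arc_mult_def)
  have "laplacian G u v * z v
      = int (arc_mult G v u) * z v - (if v = u then int (card (in_arcs G u)) * z u else 0)" for v
    using no_loop card_out_arcs_eq_card_in_arcs[OF u] by (auto simp: laplacian_def out_degree_def)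
  then have "laplacian_app G z u
      = (\<Sum>v\<in>verts G. int (arc_mult G v u) * z v) - int (card (in_arcs G u)) * z u"
    using u by (simp add: laplacian_app_def sum_subtractf)
  moreover have "(\<Sum>v\<in>verts G. int (arc_mult G v u) * z v) = (\<Sum>e\<in>in_arcs G u. z (tail G e))"
  proof -
    have "(\<Sum>v\<in>verts G. \<Sum>e | e \<in> in_arcs G u \<and> tail G e = v. z (tail G e))
        = (\<Sum>e\<in>in_arcs G u. z (tail G e))"
      by (rule sum.group) auto
    moreover have "(\<Sum>e | e \<in> in_arcs G u \<and> tail G e = v. z (tail G e))
        = int (arc_mult G v u) * z v" for v
    proof -
      have "(\<Sum>e | e \<in> in_arcs G u \<and> tail G e = v. z (tail G e))
          = (\<Sum>e | e \<in> in_arcs G u \<and> tail G e = v. z v)"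
        by (rule sum.cong) auto
      moreover have "{e. e \<in> in_arcs G u \<and> tail G e = v} = {e \<in> arcs G. tail G e = v \<and> head G e = u}"
        by auto
      ultimately show ?thesis by (simp add: arc_mult_def del: in_in_arcs_conv)
    qed
    ultimately show ?thesis by (simp only:)
  qed
  ultimately show ?thesis by (simp add: sum_subtractf)
qed

lemma laplacian_app_outside: "v \<notin> verts G \<Longrightarrow> laplacian_app G z v = 0"
  by (simp add: laplacian_app_def)

lemma laplacian_app_add:
  "laplacian_app G (\<lambda>v. y v + z v) u = laplacian_app G y u + laplacian_app G z u"
  by (simp add: laplacian_app_def distrib_left sum.distrib)

lemma laplacian_app_minus: "laplacian_app G (\<lambda>v. - z v) u = - laplacian_app G z u"
  by (simp add: laplacian_app_def sum_negf)

lemma laplacian_app_diff: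
  "laplacian_app G (\<lambda>v. y v - z v) u = laplacian_app G y u - laplacian_app G z u"
  by (simp add: laplacian_app_def right_diff_distrib sum_subtractf)

lemma laplacian_app_cong:
  "(\<And>v. v \<in> verts G \<Longrightarrow> y v = z v) \<Longrightarrow> laplacian_app G y u = laplacian_app G z u"
  by (simp add: laplacian_app_def)

lemma div_deg_laplacian_app: "div_deg G (laplacian_app G z) = 0"
proof -
  have "div_deg G (laplacian_app G z)
      = (\<Sum>u\<in>verts G. \<Sum>e\<in>in_arcs G u. z (tail G e)) - (\<Sum>u\<in>verts G. \<Sum>e\<in>in_arcs G u. z u)"
    by (simp add: div_deg_def laplacian_app_eq sum_subtractf)
  also have "(\<Sum>u\<in>verts G. \<Sum>e\<in>in_arcs G u. z (tail G e)) = (\<Sum>e\<in>arcs G. z (tail G e))"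
    by (subst sum_in_arcs) (auto intro: sum.cong)
  also have "\<dots> = (\<Sum>u\<in>verts G. \<Sum>e\<in>out_arcs G u. z (tail G e))"
    by (subst sum_out_arcs) (auto intro: sum.cong)
  also have "\<dots> = (\<Sum>u\<in>verts G. \<Sum>e\<in>in_arcs G u. z u)"
    by (rule sum.cong) (simp_all add: card_out_arcs_eq_card_in_arcs)
  finally show ?thesis by simp
qed

lemma div_deg_add: "div_deg G (\<lambda>v. f v + g v) = div_deg G f + div_deg G g"
  by (simp add: div_deg_def sum.distrib)

lemma div_deg_diff: "div_deg G (f - g) = div_deg G f - div_deg G g"
  by (simp add: div_deg_def sum_subtractf)

text \<open>
  A weakly connected Eulerian digraph is strongly connected, in the form used below. As many arcs
  start in \<open>S\<close> as end in \<open>S\<close>; if every arc ending in \<open>S\<close> also starts there, then conversely every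
  arc starting in \<open>S\<close> ends there, and \<open>S\<close> is a union of weak components.
\<close>

lemma closed_under_predecessors_eq_verts:
  assumes "S \<subseteq> verts G" "S \<noteq> {}"
    and closed: "\<And>e. e \<in> arcs G \<Longrightarrow> head G e \<in> S \<Longrightarrow> tail G e \<in> S"
  shows "S = verts G"
proof -
  have fin: "finite S"
    using assms(1) finite_verts finite_subset by blast
  have "card {e \<in> arcs G. head G e \<in> S} = (\<Sum>v\<in>S. card (in_arcs G v))"
    using sum_in_arcs[OF fin, of "\<lambda>_. 1 :: nat"] by simp
  also have "\<dots> = (\<Sum>v\<in>S. card (out_arcs G v))"
    using assms(1) by (intro sum.cong) (auto simp: card_out_arcs_eq_card_in_arcs)
  also have "\<dots> = card {e \<in> arcs G. tail G e \<in> S}"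
    using sum_out_arcs[OF fin, of "\<lambda>_. 1 :: nat"] by simp
  finally have "{e \<in> arcs G. head G e \<in> S} = {e \<in> arcs G. tail G e \<in> S}"
    using closed by (intro card_subset_eq) auto
  then have iff: "head G e \<in> S \<longleftrightarrow> tail G e \<in> S" if "e \<in> arcs G" for e
    using that by blast
  obtain s where s: "s \<in> S" using assms(2) by blast
  interpret S: pair_wf_digraph "mk_symmetric G" ..
  have "v \<in> S" if "v \<in> verts G" for v
  proof -
    have "s \<rightarrow>\<^sup>*\<^bsub>with_proj (mk_symmetric G)\<^esub> v"
      using connected_G s assms(1) that by (auto simp: connected_def strongly_connected_def)
    then show "v \<in> S"
    proof (induction rule: S.reachable_induct)
      case base
      then show ?case using s by blast
    next
      case (step x y)
      then show ?case using iff by (auto simp: parcs_mk_symmetric arcs_ends_conv)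
    qed
  qed
  then show ?thesis using assms(1) by blast
qed

text \<open>
  The maximum principle: where \<open>z\<close> is maximal and the Laplacian vanishes, a sum of nonnegative
  differences is zero, so all predecessors are maximal too.
\<close>

lemma laplacian_kernel_constant:
  assumes zero: "\<And>v. v \<in> verts G \<Longrightarrow> laplacian_app G z v = 0"
    and "u \<in> verts G" "v \<in> verts G"
  shows "z u = z v"
proof -
  define m where "m = Max (z ` verts G)"
  define S where "S = {v \<in> verts G. z v = m}"
  have le: "z v \<le> m" if "v \<in> verts G" for v
    using that by (simp add: m_def)
  have "m \<in> z ` verts G"
    unfolding m_def using verts_nonempty by (intro Max_in) auto
  then have "S \<noteq> {}" by (auto simp: S_def)
  moreover have "tail G e \<in> S" if e: "e \<in> arcs G" "head G e \<in> S" for e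
  proof -
    have "(\<Sum>e'\<in>in_arcs G (head G e). m - z (tail G e')) = 0"
      using zero[of "head G e"] laplacian_app_eq[of "head G e" z] e
      by (simp add: S_def sum_subtractf)
    then have "\<forall>e'\<in>in_arcs G (head G e). m - z (tail G e') = 0"
      by (subst (asm) sum_nonneg_eq_0_iff) (auto intro: le)
    then show ?thesis using e by (auto simp: S_def)
  qed
  ultimately have "S = verts G"
    by (intro closed_under_predecessors_eq_verts) (auto simp: S_def)
  then have "u \<in> S" "v \<in> S" using assms(2,3) by simp_all
  then show ?thesis by (simp add: S_def)
qed

text \<open>
  When all of \<open>A\<close> fires, the units sent inside \<open>A\<close> cancel against part of the outdegree. What
  \<open>v\<close> loses is its outdegree minus the number of arcs from \<open>A\<close>, which by the Eulerian condition is the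
  number of arcs entering it from outside \<open>A\<close>.
\<close>

lemma laplacian_app_indicator:
  assumes "v \<in> A" "v \<in> verts G"
  shows "laplacian_app G (\<lambda>u. if u \<in> A then 1 else 0) v
    = - int (card {e \<in> in_arcs G v. tail G e \<notin> A})"
proof -
  have "laplacian_app G (\<lambda>u. if u \<in> A then 1 else 0) v
      = (\<Sum>e\<in>in_arcs G v. if tail G e \<notin> A then - 1 else 0)"
    unfolding laplacian_app_eq[OF assms(2)] using assms(1) by (intro sum.cong) auto
  also have "\<dots> = - (\<Sum>e\<in>in_arcs G v. if tail G e \<notin> A then 1 else 0)"
    by (subst sum_negf[symmetric]) (auto intro: sum.cong)
  finally show ?thesis by (simp only: card_filter_eq_sum[OF finite_in_arcs])
qed

lemma laplacian_app_nonneg: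
  assumes "v \<in> verts G" "\<And>u. u \<in> verts G \<Longrightarrow> z v \<le> z u"
  shows "0 \<le> laplacian_app G z v"
  unfolding laplacian_app_eq[OF assms(1)] using assms(2) by (intro sum_nonneg) auto

section \<open>Equi-effective divisors and the rank\<close>

text \<open>
  Negating \<open>z\<close> turns the direction of the linear equivalence around, and cutting \<open>z\<close> off outside
  the vertex set makes it a divisor.
\<close>

lemma equi_effective_iff:
  "equi_effective G f \<longleftrightarrow> (\<exists>z. effective G (\<lambda>v. f v + laplacian_app G z v))"
proof
  assume "equi_effective G f"
  then obtain h z where "effective G h" and f: "f = (\<lambda>v. h v + laplacian_app G z v)"
    by (auto simp: equi_effective_def lin_equiv_def)
  moreover have "(\<lambda>v. f v + laplacian_app G (\<lambda>v. - z v) v) = h"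
    by (simp add: f laplacian_app_minus)
  ultimately show "\<exists>z. effective G (\<lambda>v. f v + laplacian_app G z v)"
    by metis
next
  assume "\<exists>z. effective G (\<lambda>v. f v + laplacian_app G z v)"
  then obtain z where z: "effective G (\<lambda>v. f v + laplacian_app G z v)" by blast
  define y where "y v = (if v \<in> verts G then - z v else 0)" for v
  have "laplacian_app G y v = - laplacian_app G z v" for v
    by (subst laplacian_app_minus[symmetric]) (auto intro: laplacian_app_cong simp: y_def)
  moreover have "y \<in> Div G" by (simp add: Div_def y_def)
  ultimately have "lin_equiv G f (\<lambda>v. f v + laplacian_app G z v)"
    unfolding lin_equiv_def by (intro bexI[of _ y]) auto
  with z show "equi_effective G f" by (auto simp: equi_effective_def)
qed

lemma equi_effective_shift:
  "equi_effective G (\<lambda>v. f v + laplacian_app G z v) \<longleftrightarrow> equi_effective G f"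
proof
  assume "equi_effective G (\<lambda>v. f v + laplacian_app G z v)"
  then obtain y where "effective G (\<lambda>v. f v + laplacian_app G z v + laplacian_app G y v)"
    by (auto simp: equi_effective_iff)
  then have "effective G (\<lambda>v. f v + laplacian_app G (\<lambda>v. z v + y v) v)"
    by (simp add: laplacian_app_add add.assoc)
  then show "equi_effective G f" unfolding equi_effective_iff by blast
next
  assume "equi_effective G f"
  then obtain y where "effective G (\<lambda>v. f v + laplacian_app G y v)"
    by (auto simp: equi_effective_iff)
  then have "effective G (\<lambda>v. f v + laplacian_app G z v + laplacian_app G (\<lambda>v. y v - z v) v)"
    by (simp add: laplacian_app_diff)
  then show "equi_effective G (\<lambda>v. f v + laplacian_app G z v)"
    unfolding equi_effective_iff by blast
qed

lemma equi_effective_mono: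
  assumes "equi_effective G f" "g \<in> Div G" "\<And>v. v \<in> verts G \<Longrightarrow> f v \<le> g v"
  shows "equi_effective G g"
proof -
  obtain z where z: "effective G (\<lambda>v. f v + laplacian_app G z v)"
    using assms(1) by (auto simp: equi_effective_iff)
  have "effective G (\<lambda>v. g v + laplacian_app G z v)"
    unfolding effective_def
  proof
    show "(\<lambda>v. g v + laplacian_app G z v) \<in> Div G"
      using assms(2) by (simp add: Div_def laplacian_app_outside)
    show "\<forall>v\<in>verts G. 0 \<le> g v + laplacian_app G z v"
      using z assms(3) by (fastforce simp: effective_def)
  qed
  then show ?thesis unfolding equi_effective_iff by blast
qed

lemma equi_effective_imp_div_deg_nonneg:
  assumes "equi_effective G f"
  shows "0 \<le> div_deg G f"
proof -
  obtain z where "effective G (\<lambda>v. f v + laplacian_app G z v)"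
    using assms by (auto simp: equi_effective_iff)
  then have "0 \<le> div_deg G (\<lambda>v. f v + laplacian_app G z v)"
    by (simp add: div_deg_def effective_def sum_nonneg)
  then show ?thesis
    by (simp add: div_deg_add div_deg_laplacian_app)
qed

lemma effective_div_deg_nonneg: "effective G g \<Longrightarrow> 0 \<le> div_deg G g"
  by (simp add: div_deg_def effective_def sum_nonneg)

text \<open>
  The rank is a least element of a set of integers, so it is meaningful only because that set is
  bounded below and inhabited: an effective divisor of degree greater than that of \<open>f\<close> makes the
  degree of the difference negative, and such a difference is not equi-effective.
\<close>

lemma div_rank_attained_and_minimal:
  shows div_rank_attained:
      "\<exists>g. effective G g \<and> \<not> equi_effective G (f - g) \<and> div_rank G f = div_deg G g - 1"
    and div_rank_le: "effective G g \<Longrightarrow> \<not> equi_effective G (f - g) \<Longrightarrow> div_rank G f \<le> div_deg G g - 1"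
proof -
  define P where
    "P r \<longleftrightarrow> (\<exists>g. effective G g \<and> \<not> equi_effective G (f - g) \<and> r = div_deg G g - 1)" for r
  have bound: "-1 \<le> r" if "P r" for r
    using that effective_div_deg_nonneg by (fastforce simp: P_def)
  have "\<exists>r. P r"
  proof -
    obtain q where q: "q \<in> verts G" using verts_nonempty by blast
    define g where "g v = (if v = q then \<bar>div_deg G f\<bar> + 1 else 0)" for v
    have "effective G g" using q by (auto simp: effective_def Div_def g_def)
    moreover have "div_deg G g = \<bar>div_deg G f\<bar> + 1"
      using q by (simp add: div_deg_def g_def)
    then have "div_deg G (f - g) < 0" by (simp add: div_deg_diff)
    then have "\<not> equi_effective G (f - g)"
      using equi_effective_imp_div_deg_nonneg[of "f - g"] by linarith
    ultimately show ?thesis unfolding P_def by blast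
  qed
  then obtain r where r: "P r" "\<And>s. P s \<Longrightarrow> nat (r + 1) \<le> nat (s + 1)"
    using ex_has_least_nat[of P _ "\<lambda>r. nat (r + 1)"] by blast
  have min: "r \<le> s" if "P s" for s
    using r(2)[OF that] bound[OF that] by linarith
  have least: "div_rank G f = r"
    unfolding div_rank_def P_def[symmetric] using r(1) min by (rule Least_equality)
  show "\<exists>g. effective G g \<and> \<not> equi_effective G (f - g) \<and> div_rank G f = div_deg G g - 1"
    using r(1) by (simp add: least P_def)
  show "div_rank G f \<le> div_deg G g - 1" if "effective G g" "\<not> equi_effective G (f - g)"
    using min[of "div_deg G g - 1"] that unfolding least P_def by blast
qed

section \<open>Divisors of vertex orders\<close>

lemma order_div_in_Div: "order_div G p \<in> Div G"
  by (simp add: Div_def order_div_def)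

text \<open>
  Let \<open>v\<close> be the earliest vertex among those maximizing \<open>z\<close>. All arcs from earlier
  vertices enter \<open>v\<close> from vertices with a smaller value of \<open>z\<close>, so each of them costs \<open>v\<close> at least one,
  and no arc brings a gain. As \<open>v\<close> had one less than the number of these arcs, it is left negative.
\<close>

lemma not_equi_effective_order_div: "\<not> equi_effective G (order_div G p)"
proof
  assume "equi_effective G (order_div G p)"
  then obtain z where z: "effective G (\<lambda>v. order_div G p v + laplacian_app G z v)"
    by (auto simp: equi_effective_iff)
  define m where "m = Max (z ` verts G)"
  define S where "S = {v \<in> verts G. z v = m}"
  have le: "z v \<le> m" if "v \<in> verts G" for v
    using that by (simp add: m_def)
  have "m \<in> z ` verts G"
    unfolding m_def using verts_nonempty by (intro Max_in) auto
  then have "S \<noteq> {}" by (auto simp: S_def)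
  moreover have "finite S" by (simp add: S_def)
  ultimately obtain v where v: "v \<in> S" "\<And>u. u \<in> S \<Longrightarrow> p v \<le> p u"
    using arg_min_if_finite[of S p] by (metis not_le)
  let ?E = "{e \<in> in_arcs G v. p (tail G e) < p v}"
  have vV: "v \<in> verts G" and zv: "z v = m" using v by (auto simp: S_def)
  have "laplacian_app G z v \<le> (\<Sum>e\<in>in_arcs G v. if e \<in> ?E then - 1 else 0)"
    unfolding laplacian_app_eq[OF vV]
  proof (rule sum_mono)
    fix e assume e: "e \<in> in_arcs G v"
    show "z (tail G e) - z v \<le> (if e \<in> ?E then - 1 else 0)"
    proof (cases "e \<in> ?E")
      case True
      then have "tail G e \<notin> S" using v(2) by force
      then have "z (tail G e) \<noteq> m" using e by (auto simp: S_def)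
      then show ?thesis using le[of "tail G e"] e zv True by auto
    next
      case False
      have "z (tail G e) \<le> z v" using le[of "tail G e"] e zv by auto
      with False show ?thesis by auto
    qed
  qed
  also have "\<dots> = - int (card ?E)"
    by (simp add: sum.If_cases Int_def in_arcs_def)
  finally have "order_div G p v + laplacian_app G z v < 0"
    using vV by (simp add: order_div_def)
  with z vV show False by (fastforce simp: effective_def)
qed

lemma canonical_div_minus_order_div:
  assumes "inj_on p (verts G)"
  shows "canonical_div G - order_div G p = order_div G (\<lambda>v. - p v)"
proof
  fix v
  show "(canonical_div G - order_div G p) v = order_div G (\<lambda>v. - p v) v"
  proof (cases "v \<in> verts G")
    case True
    have p_neq: "p (tail G e) \<noteq> p v" if "e \<in> in_arcs G v" for e
      using assms no_loops[of e] that tail_in_verts[of e] head_in_verts[of e]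
      by (auto simp: inj_on_def)
    have "in_arcs G v = {e \<in> in_arcs G v. p (tail G e) < p v} \<union> {e \<in> in_arcs G v. p v < p (tail G e)}"
      using p_neq True by fastforce
    moreover have "card ({e \<in> in_arcs G v. p (tail G e) < p v} \<union> {e \<in> in_arcs G v. p v < p (tail G e)})
        = card {e \<in> in_arcs G v. p (tail G e) < p v} + card {e \<in> in_arcs G v. p v < p (tail G e)}"
      by (rule card_Un_disjoint) auto
    ultimately have "card (in_arcs G v)
        = card {e \<in> in_arcs G v. p (tail G e) < p v} + card {e \<in> in_arcs G v. p v < p (tail G e)}"
      by argo
    then show ?thesis
      using True card_out_arcs_eq_card_in_arcs[OF True]
      by (simp add: canonical_div_def order_div_def out_degree_def)
  next
    case False
    then show ?thesis by (simp add: canonical_div_def order_div_def)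
  qed
qed

lemma div_deg_order_div:
  "div_deg G (order_div G p)
    = int (card {e \<in> arcs G. p (tail G e) < p (head G e)}) - int (card (verts G))"
proof -
  have "(\<Sum>v\<in>verts G. int (card {e \<in> in_arcs G v. p (tail G e) < p v}))
      = (\<Sum>v\<in>verts G. \<Sum>e\<in>in_arcs G v. if p (tail G e) < p (head G e) then 1 else 0)"
    unfolding card_filter_eq_sum[OF finite_in_arcs] by (intro sum.cong) auto
  also have "\<dots> = (\<Sum>e\<in>arcs G. if p (tail G e) < p (head G e) then 1 else 0)"
    by (subst sum_in_arcs) (auto intro: sum.cong)
  also have "\<dots> = int (card {e \<in> arcs G. p (tail G e) < p (head G e)})"
    by (simp add: card_filter_eq_sum)
  finally show ?thesis
    by (simp add: div_deg_def order_div_def sum_subtractf del: in_in_arcs_conv)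
qed

text \<open>
  Along the remaining arcs the position strictly increases, so no walk returns to its start.
\<close>

lemma backward_arcs_feedback_arc_set:
  "feedback_arc_set G {e \<in> arcs G. \<not> p (tail G e) < (p (head G e) :: int)}"
proof -
  let ?H = "G\<lparr>arcs := arcs G - {e \<in> arcs G. \<not> p (tail G e) < p (head G e)}\<rparr>"
  have increasing: "q \<noteq> [] \<Longrightarrow> p u < p v"
    if "pre_digraph.cas ?H u q v" "set q \<subseteq> arcs ?H" for u q v
    using that
  proof (induction q arbitrary: u)
    case Nil
    then show ?case by simp
  next
    case (Cons e q)
    then have "p u < p (head G e)" and cas: "pre_digraph.cas ?H (head G e) q v"
      by (auto simp: pre_digraph.cas.simps)
    moreover have "p (head G e) \<le> p v"
    proof (cases "q = []")
      case True
      then show ?thesis using cas by (simp add: pre_digraph.cas.simps)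
    next
      case False
      then show ?thesis using Cons.IH[OF False cas] Cons.prems by auto
    qed
    ultimately show ?case by linarith
  qed
  have "acyclic_digraph ?H"
    unfolding acyclic_digraph_def pre_digraph.cycle_def pre_digraph.awalk_def
    using increasing by blast
  then show ?thesis unfolding feedback_arc_set_def by blast
qed

lemma minfas_le:
  assumes "feedback_arc_set G F"
  shows "minfas G \<le> card F"
proof -
  have "{F. feedback_arc_set G F} \<subseteq> Pow (arcs G)"
    by (auto simp: feedback_arc_set_def)
  then have "finite {F. feedback_arc_set G F}"
    by (rule finite_subset) simp
  then show ?thesis
    unfolding minfas_def using assms by (intro Min_le) auto
qed

lemma div_deg_order_div_le: "div_deg G (order_div G p) \<le> genus_max G - 1"
proof -
  let ?F = "{e \<in> arcs G. p (tail G e) < p (head G e)}"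
  let ?B = "{e \<in> arcs G. \<not> p (tail G e) < p (head G e)}"
  have "card (?F \<union> ?B) = card ?F + card ?B"
    by (rule card_Un_disjoint) auto
  moreover have "?F \<union> ?B = arcs G" by auto
  ultimately have "card (arcs G) = card ?F + card ?B" by simp
  moreover have "minfas G \<le> card ?B"
    by (rule minfas_le) (rule backward_arcs_feedback_arc_set)
  ultimately show ?thesis
    unfolding div_deg_order_div genus_max_def by linarith
qed

section \<open>Every non-equi-effective divisor lies below an order divisor\<close>

text \<open>
  Dhar's burning process. By \<open>laplacian_app_indicator\<close>, the hypothesis says that no nonempty
  set \<open>A\<close> can fire without leaving one of its members in debt. Taking for \<open>A\<close> the set of unburnt
  vertices, a member that would be in debt has fewer units than arcs from burnt vertices, so it
  burns next. The order in which the vertices burn is the order sought. The induction runs over the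
  unburnt set.
\<close>

lemma order_div_dominates_stable:
  assumes stable: "\<And>A. A \<subseteq> verts G \<Longrightarrow> A \<noteq> {} \<Longrightarrow>
      \<exists>v\<in>A. f v < int (card {e \<in> in_arcs G v. tail G e \<notin> A})"
  shows "\<exists>p. inj_on p (verts G) \<and> (\<forall>v\<in>verts G. f v \<le> order_div G p v)"
proof -
  have "\<exists>p. inj_on p A \<and>
      (\<forall>v\<in>A. f v < int (card {e \<in> in_arcs G v. tail G e \<notin> A \<or> p (tail G e) < (p v :: int)}))"
    if "A \<subseteq> verts G" for A
    using finite_subset[OF that finite_verts] that
  proof (induction A rule: finite_psubset_induct)
    case (psubset A)
    show ?case
    proof (cases "A = {}")
      case True
      then show ?thesis by auto
    next
      case False
      then obtain v where v: "v \<in> A" "f v < int (card {e \<in> in_arcs G v. tail G e \<notin> A})"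
        using stable psubset.prems by blast
      obtain p where p: "inj_on p (A - {v})"
        and dom: "\<And>w. w \<in> A - {v} \<Longrightarrow> f w < int (card {e \<in> in_arcs G w.
            tail G e \<notin> A - {v} \<or> p (tail G e) < (p w :: int)})"
        using psubset.IH[of "A - {v}"] psubset.prems v(1) by blast
      \<comment> \<open>The next vertex to burn precedes all others that are still unburnt.\<close>
      define m where "m = Min (insert 0 (p ` A)) - 1"
      have m: "m < p w" if "w \<in> A" for w
      proof -
        have "Min (insert 0 (p ` A)) \<le> p w" using that psubset.hyps by (intro Min_le) auto
        then show ?thesis by (simp add: m_def)
      qed
      define p' where "p' = p(v := m)"
      have "inj_on p' A"
      proof -
        have "inj_on p' (insert v (A - {v}))"
          unfolding p'_def using p m by (auto simp: inj_on_def)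
        then show ?thesis using v(1) by (simp add: insert_absorb)
      qed
      moreover have "f w < int (card {e \<in> in_arcs G w. tail G e \<notin> A \<or> p' (tail G e) < p' w})"
        if w: "w \<in> A" for w
      proof (cases "w = v")
        case True
        have "card {e \<in> in_arcs G v. tail G e \<notin> A}
            \<le> card {e \<in> in_arcs G v. tail G e \<notin> A \<or> p' (tail G e) < p' v}"
          by (rule card_mono) auto
        then show ?thesis using v(2) unfolding True by linarith
      next
        case False
        have "card {e \<in> in_arcs G w. tail G e \<notin> A - {v} \<or> p (tail G e) < p w}
            \<le> card {e \<in> in_arcs G w. tail G e \<notin> A \<or> p' (tail G e) < p' w}"
          using False m[OF w] by (intro card_mono) (auto simp: p'_def)
        then show ?thesis using dom[of w] w False by fastforce
      qed
      ultimately show ?thesis by blast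
    qed
  qed
  from this[of "verts G"] obtain p where p: "inj_on p (verts G)"
    "\<And>v. v \<in> verts G \<Longrightarrow>
      f v < int (card {e \<in> in_arcs G v. tail G e \<notin> verts G \<or> p (tail G e) < (p v :: int)})"
    by blast
  moreover have "{e \<in> in_arcs G v. tail G e \<notin> verts G \<or> p (tail G e) < p v}
      = {e \<in> in_arcs G v. p (tail G e) < p v}" for v
    by auto
  ultimately show ?thesis by (fastforce simp: order_div_def)
qed

lemma finite_bounded_below_fixed_degree:
  "finite {h \<in> Div G. (\<forall>v\<in>verts G. c \<le> h v) \<and> div_deg G h = d}"
proof (rule finite_subset)
  let ?u = "c + d - int (card (verts G)) * c"
  show "finite {h. \<forall>v. (v \<in> verts G \<longrightarrow> h v \<in> {c..?u}) \<and> (v \<notin> verts G \<longrightarrow> h v = 0)}"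
    by (rule finite_set_of_finite_funs) auto
  show "{h \<in> Div G. (\<forall>v\<in>verts G. c \<le> h v) \<and> div_deg G h = d}
      \<subseteq> {h. \<forall>v. (v \<in> verts G \<longrightarrow> h v \<in> {c..?u}) \<and> (v \<notin> verts G \<longrightarrow> h v = 0)}"
  proof
    fix h assume "h \<in> {h \<in> Div G. (\<forall>v\<in>verts G. c \<le> h v) \<and> div_deg G h = d}"
    then have h: "h \<in> Div G \<and> (\<forall>v\<in>verts G. c \<le> h v) \<and> div_deg G h = d" by simp
    have "h v \<le> ?u" if "v \<in> verts G" for v
    proof -
      have "h v - c \<le> (\<Sum>w\<in>verts G. h w - c)"
        using h that by (intro member_le_sum) auto
      also have "\<dots> = d - int (card (verts G)) * c"
        using h by (simp add: sum_subtractf div_deg_def)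
      finally show ?thesis by simp
    qed
    then show "h \<in> {h. \<forall>v. (v \<in> verts G \<longrightarrow> h v \<in> {c..?u}) \<and> (v \<notin> verts G \<longrightarrow> h v = 0)}"
      using h by (simp add: Div_def)
  qed
qed

text \<open>
  Equivalent divisors share their degree, so a lower bound on the values leaves only finitely many
  of them; and fixing \<open>z\<close> at one vertex makes \<open>z\<close> determined by the resulting divisor, since
  the kernel of the Laplacian consists of the constants.
\<close>

lemma finite_firings_bounded_below:
  assumes f: "f \<in> Div G" and q: "q \<in> verts G"
  shows "finite {z. z q = 0 \<and> z \<in> Div G \<and> (\<forall>v\<in>verts G. c \<le> f v + laplacian_app G z v)}"
    (is "finite ?Z")
proof (rule finite_imageD)
  let ?F = "\<lambda>z v. f v + laplacian_app G z v"
  have "?F ` ?Z \<subseteq> {h \<in> Div G. (\<forall>v\<in>verts G. c \<le> h v) \<and> div_deg G h = div_deg G f}"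
    using f by (auto simp: div_deg_add div_deg_laplacian_app Div_def laplacian_app_outside)
  then show "finite (?F ` ?Z)"
    by (rule finite_subset) (rule finite_bounded_below_fixed_degree)
  show "inj_on ?F ?Z"
  proof (rule inj_onI)
    fix y z assume y: "y \<in> ?Z" and z: "z \<in> ?Z" and eq: "?F y = ?F z"
    have "laplacian_app G (\<lambda>v. y v - z v) v = 0" for v
      using fun_cong[OF eq, of v] by (simp add: laplacian_app_diff)
    then have "y v - z v = y q - z q" if "v \<in> verts G" for v
      using laplacian_kernel_constant[of "\<lambda>v. y v - z v" v q] that q by blast
    then have "y v = z v" if "v \<in> verts G" for v
      using that y z by simp
    moreover have "y v = z v" if "v \<notin> verts G" for v
      using that y z by (simp add: Div_def)
    ultimately show "y = z" by blast
  qed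
qed

text \<open>
  Two extremal choices produce the representative. Among all equivalent divisors,
  \<open>f0\<close> minimizes the total debt; its set \<open>B\<close> of vertices in debt is nonempty. Among the firings that
  leave \<open>B\<close> alone and keep everything else out of debt, \<open>z\<close> has the largest total, which
  exists by finiteness. Such firings can only help \<open>B\<close>, so minimality of the debt keeps \<open>B\<close> in debt. A set that
  could still fire would have to avoid \<open>B\<close>, and firing it would increase the total.
\<close>

lemma exists_stable_representative:
  assumes f: "f \<in> Div G" and not_equi: "\<not> equi_effective G f"
  shows "\<exists>z. \<forall>A. A \<subseteq> verts G \<longrightarrow> A \<noteq> {} \<longrightarrow>
    (\<exists>v\<in>A. f v + laplacian_app G z v < int (card {e \<in> in_arcs G v. tail G e \<notin> A}))"
proof -
  define debt where "debt h = (\<Sum>v\<in>verts G. nat (- h v))" for h :: "'a \<Rightarrow> int"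
  obtain y where y: "\<And>z. debt (\<lambda>v. f v + laplacian_app G y v) \<le> debt (\<lambda>v. f v + laplacian_app G z v)"
    using ex_has_least_nat[of "\<lambda>_. True" _ "\<lambda>z. debt (\<lambda>v. f v + laplacian_app G z v)"] by blast
  define f0 where "f0 v = f v + laplacian_app G y v" for v
  have f0: "f0 \<in> Div G" using f by (simp add: f0_def Div_def laplacian_app_outside)
  have min_debt: "debt f0 \<le> debt (\<lambda>v. f0 v + laplacian_app G z v)" for z
    using y[of "\<lambda>v. y v + z v"] by (simp add: f0_def[abs_def] laplacian_app_add add.assoc)
  define B where "B = {v \<in> verts G. f0 v < 0}"
  have "\<not> effective G f0"
    using not_equi unfolding equi_effective_iff f0_def[abs_def] by blast
  then obtain q where q: "q \<in> B"
    using f0 by (auto simp: effective_def B_def not_le)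
  define Z where "Z = {z. (\<forall>v. v \<notin> verts G - B \<longrightarrow> z v = 0) \<and> (\<forall>v. 0 \<le> z v)
      \<and> (\<forall>v\<in>verts G - B. 0 \<le> f0 v + laplacian_app G z v)}"
  have on_B: "f0 v \<le> f0 v + laplacian_app G z v" if "z \<in> Z" "v \<in> B" for z v
    using that laplacian_app_nonneg[of v z] by (auto simp: Z_def B_def)
  define c where "c = Min (insert 0 (f0 ` verts G))"
  have c: "c \<le> 0" "\<And>v. v \<in> verts G \<Longrightarrow> c \<le> f0 v"
    by (auto simp: c_def)
  have "Z \<subseteq> {z. z q = 0 \<and> z \<in> Div G \<and> (\<forall>v\<in>verts G. c \<le> f0 v + laplacian_app G z v)}"
  proof
    fix z assume z: "z \<in> Z"
    have "c \<le> f0 v + laplacian_app G z v" if v: "v \<in> verts G" for v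
    proof (cases "v \<in> B")
      case True
      then show ?thesis using on_B[OF z] c(2)[OF v] by fastforce
    next
      case False
      then have "0 \<le> f0 v + laplacian_app G z v" using z v by (simp add: Z_def)
      then show ?thesis using c(1) by linarith
    qed
    then show "z \<in> {z. z q = 0 \<and> z \<in> Div G \<and> (\<forall>v\<in>verts G. c \<le> f0 v + laplacian_app G z v)}"
      using z q by (auto simp: Z_def Div_def)
  qed
  then have "finite Z"
    by (rule finite_subset) (rule finite_firings_bounded_below, use f0 q in \<open>auto simp: B_def\<close>)
  moreover have "(\<lambda>_. 0) \<in> Z"
    by (auto simp: Z_def B_def laplacian_app_def)
  then have "Z \<noteq> {}" by blast
  ultimately obtain z where z: "z \<in> Z"
    and max: "\<And>y. y \<in> Z \<Longrightarrow> (\<Sum>v\<in>verts G. y v) \<le> (\<Sum>v\<in>verts G. z v)"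
    using Max_in[of "(\<lambda>z. \<Sum>v\<in>verts G. z v) ` Z"] Max_ge[of "(\<lambda>z. \<Sum>v\<in>verts G. z v) ` Z"]
    by (smt (verit, ccfv_threshold) finite_imageI image_iff image_is_empty)
  define f1 where "f1 v = f0 v + laplacian_app G z v" for v
  \<comment> \<open>If a vertex of \<open>B\<close> got out of debt, then the total debt would have dropped.\<close>
  have neg: "f1 v < 0" if v: "v \<in> B" for v
  proof (rule ccontr)
    assume "\<not> f1 v < 0"
    have "debt f1 < debt f0"
      unfolding debt_def
    proof (rule sum_strict_mono_ex1)
      show "\<forall>w\<in>verts G. nat (- f1 w) \<le> nat (- f0 w)"
      proof
        fix w assume w: "w \<in> verts G"
        show "nat (- f1 w) \<le> nat (- f0 w)"
        proof (cases "w \<in> B")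
          case True
          then show ?thesis using on_B[OF z True] by (simp add: f1_def)
        next
          case False
          then have "0 \<le> f1 w" using z w by (simp add: Z_def f1_def)
          then show ?thesis by simp
        qed
      qed
      show "\<exists>w\<in>verts G. nat (- f1 w) < nat (- f0 w)"
        using v \<open>\<not> f1 v < 0\<close> by (intro bexI[of _ v]) (auto simp: B_def)
    qed simp
    with min_debt[of z] show False by (simp add: f1_def[abs_def])
  qed
  have "\<exists>v\<in>A. f1 v < int (card {e \<in> in_arcs G v. tail G e \<notin> A})"
    if A: "A \<subseteq> verts G" "A \<noteq> {}" for A
  proof (rule ccontr)
    assume "\<not> ?thesis"
    then have can_fire: "int (card {e \<in> in_arcs G v. tail G e \<notin> A}) \<le> f1 v" if "v \<in> A" for v
      using that by force
    then have disj: "v \<notin> B" if "v \<in> A" for v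
      using neg[of v] that by force
    define z' where "z' v = z v + (if v \<in> A then 1 else 0)" for v
    have lap: "f0 v + laplacian_app G z' v
        = f1 v + laplacian_app G (\<lambda>u. if u \<in> A then 1 else 0) v" for v
      by (simp add: z'_def[abs_def] f1_def laplacian_app_add)
    have "0 \<le> f0 v + laplacian_app G z' v" if v: "v \<in> verts G - B" for v
    proof (cases "v \<in> A")
      case True
      then show ?thesis
        using can_fire[OF True] laplacian_app_indicator[OF True] v by (simp add: lap)
    next
      case False
      then have "0 \<le> laplacian_app G (\<lambda>u. if u \<in> A then 1 else 0) v"
        using v by (intro laplacian_app_nonneg) auto
      moreover have "0 \<le> f1 v" using z v by (simp add: Z_def f1_def)
      ultimately show ?thesis by (simp add: lap)
    qed
    then have "z' \<in> Z"
      using z A disj by (auto simp: Z_def z'_def)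
    moreover have "(\<Sum>v\<in>verts G. z' v) = (\<Sum>v\<in>verts G. z v) + int (card A)"
      using A(1) by (simp add: z'_def sum.distrib sum.If_cases Int_absorb1)
    moreover have "card A > 0"
      using A finite_subset[OF A(1) finite_verts] by (simp add: card_gt_0_iff)
    ultimately show False using max[of z'] by simp
  qed
  then have "\<forall>A. A \<subseteq> verts G \<longrightarrow> A \<noteq> {} \<longrightarrow>
      (\<exists>v\<in>A. f v + laplacian_app G (\<lambda>v. y v + z v) v < int (card {e \<in> in_arcs G v. tail G e \<notin> A}))"
    by (simp add: f1_def f0_def laplacian_app_add add.assoc)
  then show ?thesis by blast
qed

lemma not_equi_effective_imp_below_order_div:
  assumes "f \<in> Div G" "\<not> equi_effective G f"
  shows "\<exists>z p. inj_on p (verts G) \<and> (\<forall>v\<in>verts G. f v + laplacian_app G z v \<le> order_div G p v)"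
proof -
  obtain z where "\<And>A. A \<subseteq> verts G \<Longrightarrow> A \<noteq> {} \<Longrightarrow>
      \<exists>v\<in>A. f v + laplacian_app G z v < int (card {e \<in> in_arcs G v. tail G e \<notin> A})"
    using exists_stable_representative[OF assms] by blast
  from order_div_dominates_stable[of "\<lambda>v. f v + laplacian_app G z v", OF this] show ?thesis
    by blast
qed

section \<open>The Riemann-Roch inequality\<close>

lemma rank_difference_lower_bound:
  assumes f: "f \<in> Div G"
  shows "div_deg G f - genus_max G + 1 \<le> div_rank G f - div_rank G (canonical_div G - f)"
proof -
  obtain g where g: "effective G g" "\<not> equi_effective G (f - g)"
    and rank_f: "div_rank G f = div_deg G g - 1"
    using div_rank_attained by blast
  have "f - g \<in> Div G" using f g(1) by (simp add: Div_def effective_def)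
  then obtain z p where inj: "inj_on p (verts G)"
    and below: "\<And>v. v \<in> verts G \<Longrightarrow> (f - g) v + laplacian_app G z v \<le> order_div G p v"
    using not_equi_effective_imp_below_order_div[OF _ g(2)] by blast
  define e where "e v = order_div G p v - ((f - g) v + laplacian_app G z v)" for v
  have e: "effective G e"
    using below f g(1) order_div_in_Div[of p]
    by (auto simp: effective_def Div_def e_def laplacian_app_outside)
  have deg_e: "div_deg G e = div_deg G (order_div G p) - div_deg G f + div_deg G g"
  proof -
    have "e = order_div G p - (\<lambda>v. (f - g) v + laplacian_app G z v)"
      by (simp add: e_def fun_eq_iff)
    then show ?thesis
      by (simp only: div_deg_diff div_deg_add div_deg_laplacian_app)
  qed
  have "\<not> equi_effective G (canonical_div G - f - e)"
  proof
    assume "equi_effective G (canonical_div G - f - e)"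
    then have "equi_effective G (\<lambda>v. (canonical_div G - f - e) v + laplacian_app G (\<lambda>v. - z v) v)"
      by (simp only: equi_effective_shift)
    moreover have "(canonical_div G - f - e) v + laplacian_app G (\<lambda>v. - z v) v
        = order_div G (\<lambda>v. - p v) v - g v" for v
      using fun_cong[OF canonical_div_minus_order_div[OF inj], of v]
      by (simp add: e_def laplacian_app_minus)
    ultimately have "equi_effective G (\<lambda>v. order_div G (\<lambda>v. - p v) v - g v)"
      by simp
    then have "equi_effective G (order_div G (\<lambda>v. - p v))"
      by (rule equi_effective_mono) (use g(1) order_div_in_Div in \<open>auto simp: effective_def\<close>)
    then show False using not_equi_effective_order_div by blast
  qed
  then have "div_rank G (canonical_div G - f) \<le> div_deg G e - 1"
    using e by (intro div_rank_le)
  then show ?thesis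
    using rank_f deg_e div_deg_order_div_le[of p] by linarith
qed

lemma div_deg_canonical_div: "div_deg G (canonical_div G) = genus_max G + genus_min G - 2"
proof -
  have "(\<Sum>v\<in>verts G. card (out_arcs G v)) = card (arcs G)"
  proof -
    have "{e \<in> arcs G. tail G e \<in> verts G} = arcs G" by auto
    then show ?thesis using sum_out_arcs[of "verts G" "\<lambda>_. 1 :: nat"] by simp
  qed
  then have "(\<Sum>v\<in>verts G. int (card (out_arcs G v))) = int (card (arcs G))"
    by (metis of_nat_sum)
  then show ?thesis
    by (simp add: div_deg_def canonical_div_def out_degree_def genus_max_def genus_min_def
        sum_subtractf)
qed

end

theorem theorem4p1:
  fixes G :: "('a, 'b) pre_digraph" and f :: "'a \<Rightarrow> int"
  assumes "fin_digraph G"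
    and "loopfree_digraph G"
    and "connected G"
    and "eulerian G"
    and "f \<in> Div G"
  shows "div_deg G f - genus_max G + 1 \<le> div_rank G f - div_rank G (canonical_div G - f)
    \<and> div_rank G f - div_rank G (canonical_div G - f) \<le> div_deg G f - genus_min G + 1"
proof -
  interpret connected_eulerian_digraph G
    using assms by (simp add: connected_eulerian_digraph_def connected_eulerian_digraph_axioms_def)
  have "canonical_div G - f \<in> Div G"
    using assms(5) by (simp add: Div_def canonical_div_def)
  have involution: "canonical_div G - (canonical_div G - f) = f"
    by (simp add: fun_eq_iff)
  from rank_difference_lower_bound[OF \<open>canonical_div G - f \<in> Div G\<close>]
  have "div_deg G (canonical_div G - f) - genus_max G + 1
      \<le> div_rank G (canonical_div G - f) - div_rank G f"
    unfolding involution .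
  then show ?thesis
    using rank_difference_lower_bound[OF assms(5)]
    by (simp add: div_deg_diff div_deg_canonical_div)
qed

end
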